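(* Suppose $(\eta_n)$ is a sequence of positive real numbers with $\eta_n\to 0$ and $n^{1/2}\eta_n\to\infty$ as $n\to\infty$. Let $\hat\theta$ stand for any of the estimators $\hat\theta_S(\eta_n)$, $\hat\theta_H(\eta_n)$, or $\hat\theta_A(\eta_n)$. Let $d$ be a real number, and define the interval $D_n=[\hat\theta-d\eta_n,\hat\theta+d\eta_n]$. If $d>1$, the interval $D_n$ has infimal coverage probability converging to $1$, i.e., $$\lim_{n\to\infty}\inf_{\theta\in\mathbb{R}}P_{n,\theta}(\theta\in D_n)=1.$$ If $d<1$, $$\lim_{n\to\infty}\inf_{\theta\in\mathbb{R}}P_{n,\theta}(\theta\in D_n)=0.$$
   Context: The data $y_1,\dots,y_n$ are i.i.d. $N(\theta,1)$ with $\theta\in\mathbb{R}$ unknown (variance known and equal to $1$); $P_{n,\theta}$ denotes the distribution of the sample when $\theta$ is the true parameter, and $\bar y=n^{-1}\sum_{i=1}^n y_i$. Estimators: soft-thresholding (LASSO) $\hat\theta_S(\eta_n)=\operatorname{sign}(\bar y)(|\bar y|-\eta_n)_+$ with $z_+=\max\{z,0\}$ and $\operatorname{sign}(0)=0$; hard-thresholding $\hat\theta_H(\eta_n)=\bar y\,\mathbf{1}(|\bar y|>\eta_n)$; adaptive LASSO $\hat\theta_A(\eta_n)=0$ if $|\bar y|\le\eta_n$ and $\hat\theta_A(\eta_n)=\bar y-\eta_n^2/\bar y$ if $|\bar y|>\eta_n$. *)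

theory Defs
  imports "HOL-Probability.Probability"
begin

(* A sample of size n is a function on the index set {1..n} (extensional, as usual for PiM). *)
definition normal_sample :: "nat \<Rightarrow> real \<Rightarrow> (nat \<Rightarrow> real) measure" where
  "normal_sample n \<theta> = (\<Pi>\<^sub>M i\<in>{1..n}. density lborel (\<lambda>x. ennreal (normal_density \<theta> 1 x)))"

definition sample_mean :: "nat \<Rightarrow> (nat \<Rightarrow> real) \<Rightarrow> real" where
  "sample_mean n y = (\<Sum>i=1..n. y i) / real n"

(* In the estimators, n is the sample size, e the threshold and y the sample. *)

definition soft_threshold :: "nat \<Rightarrow> real \<Rightarrow> (nat \<Rightarrow> real) \<Rightarrow> real" where
  "soft_threshold n e y = sgn (sample_mean n y) * max (\<bar>sample_mean n y\<bar> - e) 0"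

definition hard_threshold :: "nat \<Rightarrow> real \<Rightarrow> (nat \<Rightarrow> real) \<Rightarrow> real" where
  "hard_threshold n e y = sample_mean n y * of_bool (\<bar>sample_mean n y\<bar> > e)"

definition adaptive_lasso :: "nat \<Rightarrow> real \<Rightarrow> (nat \<Rightarrow> real) \<Rightarrow> real" where
  "adaptive_lasso n e y =
     (if \<bar>sample_mean n y\<bar> \<le> e then 0 else sample_mean n y - e\<^sup>2 / sample_mean n y)"

end

theory Submission
  imports Defs
begin

text \<open>
  Two facts drive both halves. Writing \<open>m\<close> for the sample mean and \<open>e\<close> for the threshold, each
  of the three estimators stays within \<open>e\<close> of \<open>m\<close>, and each is exactly \<open>0\<close> when \<open>\<bar>m\<bar> \<le> e\<close>. On
  the other hand \<open>m\<close> is \<open>N(\<theta>, 1/n)\<close>, so by Chebyshev's inequality it deviates from \<open>\<theta>\<close> by \<open>c e\<close>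
  or more with probability at most \<open>1 / (c \<surd>n e)\<^sup>2\<close>. This bound does not involve \<open>\<theta>\<close>, and it
  vanishes in the limit because \<open>\<surd>n e \<rightarrow> \<infinity>\<close>: the threshold is asymptotically much wider than the
  noise.

  If \<open>d > 1\<close>, an estimator within \<open>e\<close> of \<open>m\<close> misses \<open>\<theta>\<close> by more than \<open>d e\<close> only if \<open>m\<close> deviates
  by more than \<open>(d - 1) e\<close>, uniformly in \<open>\<theta>\<close> (lemma \<open>coverage_ge\<close>). If \<open>d < 1\<close>, place the
  parameter at \<open>\<theta> = c e\<close> with \<open>max d 0 < c < 1\<close>. Then \<open>m\<close> falls below the threshold unless it
  deviates by at least \<open>(1 - c) e\<close>, the estimator is \<open>0\<close>, and its distance \<open>c e\<close> to \<open>\<theta>\<close> exceeds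
  \<open>d e\<close>; so the coverage at this single parameter already tends to \<open>0\<close>
  (lemma \<open>coverage_le\<close>).
\<close>

lemma prob_space_normal_sample: "prob_space (normal_sample n \<theta>)"
  unfolding normal_sample_def
  by (intro prob_space_PiM prob_space_normal_density) simp

lemma component_measurable [measurable]:
  assumes "i \<in> {1..n}"
  shows "(\<lambda>y. y i) \<in> borel_measurable (normal_sample n \<theta>)"
proof -
  have "(\<lambda>y. y i) \<in> normal_sample n \<theta> \<rightarrow>\<^sub>M density lborel (\<lambda>x. ennreal (normal_density \<theta> 1 x))"
    unfolding normal_sample_def using assms by (rule measurable_component_singleton)
  then show ?thesis by (simp cong: measurable_cong_sets)
qed

lemma sample_mean_measurable [measurable]:
  "sample_mean n \<in> borel_measurable (normal_sample n \<theta>)"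
  unfolding sample_mean_def
  by (intro borel_measurable_divide borel_measurable_sum borel_measurable_const)
     (rule component_measurable)

lemma sample_mean_distributed:
  assumes "n \<ge> 1"
  shows "distributed (normal_sample n \<theta>) lborel (sample_mean n) (normal_density \<theta> (1 / sqrt n))"
proof -
  let ?N = "density lborel (\<lambda>x. ennreal (normal_density \<theta> 1 x))"
  interpret prob_space "normal_sample n \<theta>" by (rule prob_space_normal_sample)
  have marginal: "distr (normal_sample n \<theta>) borel (\<lambda>y. y i) = ?N" if "i \<in> {1..n}" for i
  proof -
    have "distr (normal_sample n \<theta>) borel (\<lambda>y. y i) = distr (normal_sample n \<theta>) ?N (\<lambda>y. y i)"
      by (rule distr_cong) simp_all
    also have "\<dots> = ?N"
      unfolding normal_sample_def
      by (rule distr_PiM_component[OF prob_space_normal_density that]) simp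
    finally show ?thesis .
  qed
  have components: "distributed (normal_sample n \<theta>) lborel (\<lambda>y. y i) (normal_density \<theta> 1)"
    if "i \<in> {1..n}" for i
  proof -
    have "distr (normal_sample n \<theta>) lborel (\<lambda>y. y i) = distr (normal_sample n \<theta>) borel (\<lambda>y. y i)"
      by (rule distr_cong) simp_all
    then show ?thesis
      using marginal[OF that] component_measurable[OF that] by (simp add: distributed_def)
  qed
  \<comment> \<open>The joint law of the coordinates is the product of their marginals, as the coordinate tuple
    is the identity on the product space; this is the criterion for independence.\<close>
  have "distr (normal_sample n \<theta>) (\<Pi>\<^sub>M i\<in>{1..n}. borel) (\<lambda>y. \<lambda>i\<in>{1..n}. y i)
      = distr (normal_sample n \<theta>) (normal_sample n \<theta>) (\<lambda>y. y)"
  proof (rule distr_cong)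
    show "sets (\<Pi>\<^sub>M i\<in>{1..n}. borel) = sets (normal_sample n \<theta>)"
      unfolding normal_sample_def by (rule sets_PiM_cong) simp_all
    show "(\<lambda>i\<in>{1..n}. y i) = y" if "y \<in> space (normal_sample n \<theta>)" for y
      using that by (auto simp: normal_sample_def space_PiM PiE_iff extensional_restrict)
  qed simp
  also have "\<dots> = normal_sample n \<theta>" by (rule distr_id)
  also have "\<dots> = (\<Pi>\<^sub>M i\<in>{1..n}. ?N)" by (rule normal_sample_def)
  also have "\<dots> = (\<Pi>\<^sub>M i\<in>{1..n}. distr (normal_sample n \<theta>) borel (\<lambda>y. y i))"
    by (rule PiM_cong) (simp_all only: marginal)
  finally have "indep_vars (\<lambda>_. borel) (\<lambda>i y. y i) {1..n}"
    using assms by (subst indep_vars_iff_distr_eq_PiM') (auto intro: component_measurable)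
  then have "distributed (normal_sample n \<theta>) lborel (\<lambda>y. \<Sum>i\<in>{1..n}. y i)
      (normal_density (\<Sum>i\<in>{1..n}. \<theta>) (sqrt (\<Sum>i\<in>{1..n}. 1\<^sup>2)))"
    using assms by (intro sum_indep_normal components) auto
  then have "distributed (normal_sample n \<theta>) lborel (\<lambda>y. \<Sum>i=1..n. y i)
      (normal_density (n * \<theta>) (sqrt n))"
    by simp
  from normal_density_affine[OF this, where \<alpha> = "1 / n" and \<beta> = 0]
  show ?thesis
    using assms
    by (simp add: sample_mean_def[abs_def] sqrt_divide_self_eq inverse_eq_divide)
qed

text \<open>
  Chebyshev's inequality. A cruder tail bound than the Gaussian one suffices, since only
  convergence is at stake; what matters is that \<open>\<theta>\<close> does not occur on the right.
\<close>
lemma sample_mean_deviation: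
  assumes "n \<ge> 1" and "t > 0"
  shows "\<P>(y in normal_sample n \<theta>. t \<le> \<bar>sample_mean n y - \<theta>\<bar>) \<le> 1 / (real n * t\<^sup>2)"
proof -
  interpret prob_space "normal_sample n \<theta>" by (rule prob_space_normal_sample)
  have pos: "0 < 1 / sqrt n" using assms by simp
  note dist = sample_mean_distributed[OF assms(1), of \<theta>]
  note mean = normal_distributed_expectation[OF pos dist]
  have "integrable (normal_sample n \<theta>) (\<lambda>y. (sample_mean n y - \<theta>)\<^sup>2)"
    using integrable_normal_moment[OF pos, of \<theta> 2]
      distributed_integrable[OF dist, of "\<lambda>x. (x - \<theta>)\<^sup>2"] by simp
  then have "prob {y \<in> space (normal_sample n \<theta>). t \<le> \<bar>sample_mean n y - expectation (sample_mean n)\<bar>}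
      \<le> variance (sample_mean n) / t\<^sup>2"
    using assms(2) unfolding mean by (intro second_moment_method) auto
  then show ?thesis
    using normal_distributed_variance[OF pos dist] assms(1)
    by (simp add: mean power_divide)
qed

lemma thresholding_measurable:
  assumes "est \<in> {soft_threshold, hard_threshold, adaptive_lasso}"
  shows "est n e \<in> borel_measurable (normal_sample n \<theta>)"
  using assms
  by (auto simp: soft_threshold_def[abs_def] hard_threshold_def[abs_def] adaptive_lasso_def[abs_def])

text \<open>
  Above the threshold the three estimators shift the mean by \<open>e\<close>, by \<open>0\<close> and by
  \<open>e\<^sup>2 / \<bar>m\<bar> < e\<close> respectively; below it they discard a mean that is itself at most \<open>e\<close>.
\<close>
lemma thresholding_near_mean:
  assumes "est \<in> {soft_threshold, hard_threshold, adaptive_lasso}" and "e > 0"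
  shows "\<bar>est n e y - sample_mean n y\<bar> \<le> e"
proof -
  have "e\<^sup>2 / \<bar>m\<bar> \<le> e" if "\<bar>m\<bar> > e" for m :: real
    using that assms(2) by (simp add: divide_le_eq power2_eq_square mult_left_mono)
  then have "\<bar>e\<^sup>2 / m\<bar> \<le> e" if "\<bar>m\<bar> > e" for m :: real
    using that by (simp add: abs_divide)
  then show ?thesis
    using assms
    by (auto simp: soft_threshold_def hard_threshold_def adaptive_lasso_def sgn_if max_def)
qed

lemma thresholding_eq_0:
  assumes "est \<in> {soft_threshold, hard_threshold, adaptive_lasso}" and "\<bar>sample_mean n y\<bar> \<le> e"
  shows "est n e y = 0"
  using assms by (auto simp: soft_threshold_def hard_threshold_def adaptive_lasso_def)

lemma coverage_ge:
  assumes est: "est \<in> {soft_threshold, hard_threshold, adaptive_lasso}"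
    and "n \<ge> 1" "e > 0" "d > 1"
  shows "1 - 1 / (real n * ((d - 1) * e)\<^sup>2)
    \<le> \<P>(y in normal_sample n \<theta>. \<theta> \<in> {est n e y - d * e .. est n e y + d * e})"
proof -
  let ?M = "normal_sample n \<theta>"
  interpret prob_space ?M by (rule prob_space_normal_sample)
  note [measurable] = thresholding_measurable[OF est]
  let ?far = "{y \<in> space ?M. (d - 1) * e \<le> \<bar>sample_mean n y - \<theta>\<bar>}"
  have "1 - 1 / (real n * ((d - 1) * e)\<^sup>2) \<le> 1 - prob ?far"
    using sample_mean_deviation[of n "(d - 1) * e" \<theta>] assms by simp
  also have "\<dots> = prob (space ?M - ?far)"
    by (rule prob_compl[symmetric]) measurable
  also have "\<dots> \<le> \<P>(y in ?M. \<theta> \<in> {est n e y - d * e .. est n e y + d * e})"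
  proof (rule finite_measure_mono)
    show "space ?M - ?far \<subseteq> {y \<in> space ?M. \<theta> \<in> {est n e y - d * e .. est n e y + d * e}}"
    proof
      fix y assume "y \<in> space ?M - ?far"
      moreover have "\<bar>est n e y - sample_mean n y\<bar> \<le> e"
        using thresholding_near_mean[OF est] assms by simp
      ultimately show "y \<in> {y \<in> space ?M. \<theta> \<in> {est n e y - d * e .. est n e y + d * e}}"
        by (auto simp: left_diff_distrib)
    qed
  qed (simp only: atLeastAtMost_iff, measurable)
  finally show ?thesis .
qed

lemma coverage_le:
  assumes est: "est \<in> {soft_threshold, hard_threshold, adaptive_lasso}"
    and "n \<ge> 1" "e > 0" "d < c" "0 \<le> c" "c < 1"
  shows "\<P>(y in normal_sample n (c * e). c * e \<in> {est n e y - d * e .. est n e y + d * e})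
    \<le> 1 / (real n * ((1 - c) * e)\<^sup>2)"
proof -
  let ?M = "normal_sample n (c * e)"
  interpret prob_space ?M by (rule prob_space_normal_sample)
  have "\<P>(y in ?M. c * e \<in> {est n e y - d * e .. est n e y + d * e})
      \<le> \<P>(y in ?M. (1 - c) * e \<le> \<bar>sample_mean n y - c * e\<bar>)"
  proof (rule finite_measure_mono)
    have "(1 - c) * e \<le> \<bar>sample_mean n y - c * e\<bar>"
      if "c * e \<le> est n e y + d * e" for y
    proof (rule ccontr)
      assume "\<not> ?thesis"
      then have "\<bar>sample_mean n y - c * e\<bar> < e - c * e" by (simp add: left_diff_distrib)
      moreover have "0 \<le> c * e" using assms by simp
      ultimately have "\<bar>sample_mean n y\<bar> \<le> e" by linarith
      then have "est n e y = 0" by (rule thresholding_eq_0[OF est])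
      then show False using that assms by simp
    qed
    then show "{y \<in> space ?M. c * e \<in> {est n e y - d * e .. est n e y + d * e}}
        \<subseteq> {y \<in> space ?M. (1 - c) * e \<le> \<bar>sample_mean n y - c * e\<bar>}"
      by auto
  qed measurable
  also have "\<dots> \<le> 1 / (real n * ((1 - c) * e)\<^sup>2)"
    using assms by (intro sample_mean_deviation) auto
  finally show ?thesis .
qed

lemma chebyshev_bound_tendsto_0:
  fixes \<eta> :: "nat \<Rightarrow> real"
  assumes "filterlim (\<lambda>n. sqrt (real n) * \<eta> n) at_top sequentially"
  shows "(\<lambda>n. 1 / (real n * (a * \<eta> n)\<^sup>2)) \<longlonglongrightarrow> 0"
proof -
  have "(\<lambda>n. (inverse a)\<^sup>2 * (inverse (sqrt (real n) * \<eta> n))\<^sup>2) \<longlonglongrightarrow> (inverse a)\<^sup>2 * 0\<^sup>2"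
    by (intro tendsto_mult tendsto_power tendsto_const tendsto_inverse_0_at_top assms)
  then show ?thesis
    by (simp add: power_mult_distrib field_simps)
qed

theorem proposition6:
  fixes \<eta> :: "nat \<Rightarrow> real" and d :: real
    and est :: "nat \<Rightarrow> real \<Rightarrow> (nat \<Rightarrow> real) \<Rightarrow> real"
    and D :: "nat \<Rightarrow> (nat \<Rightarrow> real) \<Rightarrow> real set"
  assumes "\<And>n. n \<ge> 1 \<Longrightarrow> \<eta> n > 0"
    and "\<eta> \<longlonglongrightarrow> 0"
    and "filterlim (\<lambda>n. sqrt (real n) * \<eta> n) at_top sequentially"
    and "est \<in> {soft_threshold, hard_threshold, adaptive_lasso}"
    and "\<And>n y. D n y = {est n (\<eta> n) y - d * \<eta> n .. est n (\<eta> n) y + d * \<eta> n}"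
  shows "(d > 1 \<longrightarrow> (\<lambda>n. INF \<theta>. \<P>(y in normal_sample n \<theta>. \<theta> \<in> D n y)) \<longlonglongrightarrow> 1) \<and>
         (d < 1 \<longrightarrow> (\<lambda>n. INF \<theta>. \<P>(y in normal_sample n \<theta>. \<theta> \<in> D n y)) \<longlonglongrightarrow> 0)"
proof -
  define cov where "cov n \<theta> = \<P>(y in normal_sample n \<theta>. \<theta> \<in> D n y)" for n \<theta>
  have cov_le_1: "cov n \<theta> \<le> 1" for n \<theta>
    unfolding cov_def by (rule prob_space.prob_le_1[OF prob_space_normal_sample])
  have cov_nonneg: "0 \<le> cov n \<theta>" for n \<theta>
    unfolding cov_def by simp
  have INF_le: "(INF \<theta>. cov n \<theta>) \<le> cov n \<theta>" for n \<theta>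
    by (rule cINF_lower) (auto intro!: bdd_belowI[where m = 0] cov_nonneg)
  have positive: "eventually (\<lambda>n. n \<ge> 1 \<and> \<eta> n > 0) sequentially"
    using eventually_ge_at_top[of 1] by eventually_elim (simp add: assms(1))
  have "(\<lambda>n. INF \<theta>. cov n \<theta>) \<longlonglongrightarrow> 1" if "d > 1"
  proof (rule tendsto_sandwich)
    show "eventually (\<lambda>n. 1 - 1 / (real n * ((d - 1) * \<eta> n)\<^sup>2) \<le> (INF \<theta>. cov n \<theta>)) sequentially"
      using positive
    proof eventually_elim
      case (elim n)
      then show ?case
        using coverage_ge[OF assms(4), of n "\<eta> n" d] \<open>d > 1\<close>
        by (intro cINF_greatest) (auto simp: cov_def assms(5))
    qed
    show "eventually (\<lambda>n. (INF \<theta>. cov n \<theta>) \<le> 1) sequentially"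
      using INF_le[of _ 0] cov_le_1[of _ 0] by (intro always_eventually allI) (rule order_trans)
    show "(\<lambda>n. 1 - 1 / (real n * ((d - 1) * \<eta> n)\<^sup>2)) \<longlonglongrightarrow> 1"
      using tendsto_diff[OF tendsto_const chebyshev_bound_tendsto_0[OF assms(3)], of 1] by simp
  qed simp
  moreover have "(\<lambda>n. INF \<theta>. cov n \<theta>) \<longlonglongrightarrow> 0" if "d < 1"
  proof (rule tendsto_sandwich)
    \<comment> \<open>any number strictly between \<open>max d 0\<close> and \<open>1\<close> would do\<close>
    define c where "c = (max d 0 + 1) / 2"
    have c: "d < c" "0 \<le> c" "c < 1" using \<open>d < 1\<close> by (auto simp: c_def)
    show "eventually (\<lambda>n. (INF \<theta>. cov n \<theta>) \<le> 1 / (real n * ((1 - c) * \<eta> n)\<^sup>2)) sequentially"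
      using positive
    proof eventually_elim
      case (elim n)
      then have "cov n (c * \<eta> n) \<le> 1 / (real n * ((1 - c) * \<eta> n)\<^sup>2)"
        using coverage_le[OF assms(4) _ _ c, of n "\<eta> n"] by (simp add: cov_def assms(5))
      with INF_le show ?case by (rule order_trans)
    qed
    show "eventually (\<lambda>n. 0 \<le> (INF \<theta>. cov n \<theta>)) sequentially"
      by (intro always_eventually allI cINF_greatest cov_nonneg) simp
    show "(\<lambda>n. 1 / (real n * ((1 - c) * \<eta> n)\<^sup>2)) \<longlonglongrightarrow> 0"
      by (rule chebyshev_bound_tendsto_0[OF assms(3)])
  qed simp
  ultimately show ?thesis
    unfolding cov_def by blast
qed

end
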